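(* Consider the optimization problem $$\min_{\boldsymbol{\kappa},\boldsymbol{g}}\ \mathcal{C}(\boldsymbol{\kappa},\boldsymbol{g})\quad\text{s.t.}\quad \mathrm{P}_e(\boldsymbol{\kappa},\boldsymbol{g})\le\bar{\mathrm{P}}_e,\ \ \boldsymbol{\kappa}\in\mathbb{R}_{\ge 0}^n,\ \ \boldsymbol{g}\in\mathbb{R}_{\ge 0}^n,$$ with $\mathrm{P}_e$ and $\mathcal{C}$ as defined in the context and $0<\bar{\mathrm{P}}_e<1/2$. Let $$\rho_i=\frac{\gamma_i^2|h_i|^2}{\left(\tilde\sigma_v\sqrt{\xi_i}+|h_i|\sqrt{c_0}\right)^2},\qquad i=1,\dots,n,$$ and assume $\rho_1\ge\rho_2\ge\cdots\ge\rho_n$. Let $\epsilon=4\,[Q^{-1}(\bar{\mathrm{P}}_e)]^2$. Then an optimal solution $(\boldsymbol{\kappa},\boldsymbol{g})$ is given by $$\kappa_1=\frac{\epsilon}{\gamma_1^2}\left(1+\sqrt{\frac{\xi_1}{c_0}}\,\frac{\tilde\sigma_v}{|h_1|}\right),\qquad g_1=\left[\frac{\epsilon\,\tilde\sigma_v^2}{\gamma_1^2|h_1|^2}\left(1+\sqrt{\frac{c_0}{\xi_1}}\,\frac{|h_1|}{\tilde\sigma_v}\right)\right]^{1/2},$$ and $\kappa_i=0$, $g_i=0$ for all $i>1$.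
   Context: Let $n\ge1$ be the number of secondary users. For each $i\in\{1,\dots,n\}$, $\gamma_i>0$ is the local received SNR and $h_i\in\mathbb{C}\setminus\{0\}$ the fusion channel gain. Let $\sigma_n^2,\sigma_v^2>0$ be noise variances, $\tilde\sigma_v^2=\sigma_v^2/\sigma_n^4$ with $\tilde\sigma_v>0$, and let $c_0>0$ be the processing cost per sample. Put $\xi_i=(1+2\pi_1\gamma_i)\sigma_n^4>0$ with $\pi_1=1/2$; the $\xi_i$ are constants, independent of $(\boldsymbol{\kappa},\boldsymbol{g})$. For $\boldsymbol{\kappa}=(\kappa_1,\dots,\kappa_n)$ (numbers of samples, relaxed to be real) and $\boldsymbol{g}=(g_1,\dots,g_n)$ (amplifier gains) with nonnegative entries, define the error probability $$\mathrm{P}_e(\boldsymbol{\kappa},\boldsymbol{g})=Q\left(\frac12\Big(\sum_{i=1}^n\frac{g_i^2\kappa_i\gamma_i^2|h_i|^2}{g_i^2|h_i|^2+\kappa_i\tilde\sigma_v^2}\Big)^{1/2}\right),\qquad Q(x)=\frac1{\sqrt{2\pi}}\int_x^\infty e^{-t^2/2}\,dt,$$ where the $i$-th summand is taken to be $0$ when $\kappa_i=g_i=0$, and the system level cost $$\mathcal{C}(\boldsymbol{\kappa},\boldsymbol{g})=\sum_{i=1}^n\left(c_0\kappa_i+\xi_ig_i^2\right).$$ $Q^{-1}$ is the inverse function of the strictly decreasing bijection $Q:\mathbb{R}\to(0,1)$, and $\bar{\mathrm{P}}_e$ is the predefined error probability threshold. *)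

theory Defs
  imports "HOL-Probability.Probability"
begin

definition Qfun :: "real \<Rightarrow> real" where
  "Qfun x = 1 / sqrt (2 * pi) * (LBINT t:{x..}. exp (- (t\<^sup>2 / 2)))"

text \<open>\<open>Qfun\<close> is a bijection from the reals onto the open unit interval; its inverse is
  meaningful on that interval only.\<close>

definition Qinv :: "real \<Rightarrow> real" where
  "Qinv = inv Qfun"

definition pi_one :: real where
  "pi_one = 1 / 2"

definition xi :: "real \<Rightarrow> (nat \<Rightarrow> real) \<Rightarrow> nat \<Rightarrow> real" where
  "xi \<sigma>n \<gamma> i = (1 + 2 * pi_one * \<gamma> i) * \<sigma>n ^ 4"

text \<open>Below, \<open>\<sigma>t\<close> is the normalised fusion noise level \<open>\<sigma>v / \<sigma>n\<^sup>2\<close>.\<close>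

definition snr_term ::
  "(nat \<Rightarrow> real) \<Rightarrow> (nat \<Rightarrow> complex) \<Rightarrow> real \<Rightarrow> (nat \<Rightarrow> real) \<Rightarrow> (nat \<Rightarrow> real) \<Rightarrow> nat \<Rightarrow> real" where
  "snr_term \<gamma> h \<sigma>t \<kappa> g i =
     (if \<kappa> i = 0 \<and> g i = 0 then 0
      else ((g i)\<^sup>2 * \<kappa> i * (\<gamma> i)\<^sup>2 * (cmod (h i))\<^sup>2) /
           ((g i)\<^sup>2 * (cmod (h i))\<^sup>2 + \<kappa> i * \<sigma>t\<^sup>2))"

definition error_prob ::
  "nat \<Rightarrow> (nat \<Rightarrow> real) \<Rightarrow> (nat \<Rightarrow> complex) \<Rightarrow> real \<Rightarrow> (nat \<Rightarrow> real) \<Rightarrow> (nat \<Rightarrow> real) \<Rightarrow> real" where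
  "error_prob n \<gamma> h \<sigma>t \<kappa> g = Qfun (1 / 2 * sqrt (\<Sum>i = 1..n. snr_term \<gamma> h \<sigma>t \<kappa> g i))"

definition system_cost ::
  "nat \<Rightarrow> real \<Rightarrow> real \<Rightarrow> (nat \<Rightarrow> real) \<Rightarrow> (nat \<Rightarrow> real) \<Rightarrow> (nat \<Rightarrow> real) \<Rightarrow> real" where
  "system_cost n c0 \<sigma>n \<gamma> \<kappa> g = (\<Sum>i = 1..n. c0 * \<kappa> i + xi \<sigma>n \<gamma> i * (g i)\<^sup>2)"

text \<open>The nonnegative orthant of \<open>n\<close>-dimensional space; extensionality makes each vector
  a unique function.\<close>

definition nonneg_vecs :: "nat \<Rightarrow> (nat \<Rightarrow> real) set" where
  "nonneg_vecs n = {1..n} \<rightarrow>\<^sub>E {0..}"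

definition feasible ::
  "nat \<Rightarrow> (nat \<Rightarrow> real) \<Rightarrow> (nat \<Rightarrow> complex) \<Rightarrow> real \<Rightarrow> real \<Rightarrow> (nat \<Rightarrow> real) \<Rightarrow> (nat \<Rightarrow> real) \<Rightarrow> bool" where
  "feasible n \<gamma> h \<sigma>t Pe \<kappa> g \<longleftrightarrow>
     error_prob n \<gamma> h \<sigma>t \<kappa> g \<le> Pe \<and> \<kappa> \<in> nonneg_vecs n \<and> g \<in> nonneg_vecs n"

definition optimal_solution ::
  "nat \<Rightarrow> (nat \<Rightarrow> real) \<Rightarrow> (nat \<Rightarrow> complex) \<Rightarrow> real \<Rightarrow> real \<Rightarrow> real \<Rightarrow> real \<Rightarrow>
     (nat \<Rightarrow> real) \<Rightarrow> (nat \<Rightarrow> real) \<Rightarrow> bool" where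
  "optimal_solution n \<gamma> h \<sigma>n \<sigma>t c0 Pe \<kappa> g \<longleftrightarrow>
     is_arg_min (\<lambda>(\<kappa>, g). system_cost n c0 \<sigma>n \<gamma> \<kappa> g) (\<lambda>(\<kappa>, g). feasible n \<gamma> h \<sigma>t Pe \<kappa> g) (\<kappa>, g)"

definition rho ::
  "(nat \<Rightarrow> real) \<Rightarrow> (nat \<Rightarrow> complex) \<Rightarrow> real \<Rightarrow> real \<Rightarrow> real \<Rightarrow> nat \<Rightarrow> real" where
  "rho \<gamma> h \<sigma>n \<sigma>t c0 i =
     ((\<gamma> i)\<^sup>2 * (cmod (h i))\<^sup>2) / (\<sigma>t * sqrt (xi \<sigma>n \<gamma> i) + cmod (h i) * sqrt c0)\<^sup>2"

end

theory Submission
  imports Defs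
begin

text \<open>Since \<open>Q\<close> is strictly decreasing with \<open>Q 0 = 1/2\<close>, the error constraint says exactly that the
  SNR terms sum to at least \<open>\<epsilon>\<close>. By Cauchy--Schwarz the \<open>i\<close>-th SNR term is at most \<open>\<rho>\<^sub>i\<close> times the
  \<open>i\<close>-th cost, so every feasible point costs at least \<open>\<epsilon> / \<rho>\<^sub>1\<close>; the proposed point spends everything
  on the first user, at the equality case of Cauchy--Schwarz, with SNR exactly \<open>\<epsilon>\<close>.\<close>

section \<open>The Gaussian tail function: monotonicity, value at zero, inverse\<close>

lemma measure_std_normal_eq_set_integral:
  assumes "A \<in> sets borel"
  shows "measure std_normal_distribution A = (LBINT t:A. std_normal_density t)"
proof -
  have [measurable]: "A \<in> sets borel" by fact
  have "measure std_normal_distribution A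
      = enn2real (\<integral>\<^sup>+t. ennreal (indicator A t * std_normal_density t) \<partial>lborel)"
    unfolding measure_def
    by (subst emeasure_density) (auto intro!: arg_cong[where f = enn2real] nn_integral_cong
      split: split_indicator)
  also have "\<dots> = (LBINT t:A. std_normal_density t)"
    unfolding set_lebesgue_integral_def by (subst integral_eq_nn_integral) simp_all
  finally show ?thesis .
qed

text \<open>The density is strictly positive everywhere, so both measures have the same null sets.
  Points then carry no mass, which gives continuity of the cdf, while nonempty half-open intervals
  carry some, which gives strictness for \<open>Qfun\<close>.\<close>

lemma measure_std_normal_eq_0_iff:
  assumes "A \<in> sets borel"
  shows "measure std_normal_distribution A = 0 \<longleftrightarrow> A \<in> null_sets lborel"
proof -
  interpret real_distribution std_normal_distribution
    by (rule real_dist_normal_dist)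
  have [measurable]: "A \<in> sets borel" by fact
  have "measure std_normal_distribution A = 0 \<longleftrightarrow> emeasure std_normal_distribution A = 0"
    by (simp add: emeasure_eq_measure)
  also have "\<dots> \<longleftrightarrow> A \<in> null_sets std_normal_distribution"
    using assms by (auto simp: null_sets_def)
  also have "\<dots> \<longleftrightarrow> (AE x in lborel. x \<in> A \<longrightarrow> std_normal_density x = 0)"
    using assms by (subst null_sets_density_iff) auto
  also have "\<dots> \<longleftrightarrow> (AE x in lborel. x \<notin> A)"
    by (simp add: normal_density_pos less_imp_neq[symmetric])
  also have "\<dots> \<longleftrightarrow> A \<in> null_sets lborel"
    using assms by (subst AE_iff_null_sets) auto
  finally show ?thesis .
qed

lemma Qfun_eq_measure: "Qfun x = measure std_normal_distribution {x..}"
  by (subst measure_std_normal_eq_set_integral) (simp_all add: Qfun_def std_normal_density_def[abs_def])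

text \<open>Makes the limits, monotonicity and continuity of distribution functions available for
  \<open>Qfun\<close>. The two closed half-lines share the point \<open>x\<close>, which is a null
  set.\<close>

lemma Qfun_eq_cdf: "Qfun x = 1 - cdf std_normal_distribution x"
proof -
  interpret real_distribution std_normal_distribution
    by (rule real_dist_normal_dist)
  have "Qfun x = prob ({x<..} \<union> {x})"
    unfolding Qfun_eq_measure by (rule arg_cong[where f = prob]) auto
  also have "\<dots> = prob {x<..} + prob {x}"
    by (rule finite_measure_Union) auto
  also have "prob {x} = 0"
    by (subst measure_std_normal_eq_0_iff) auto
  also have "prob {x<..} = prob (space std_normal_distribution - {..x})"
    by (rule arg_cong[where f = prob]) auto
  also have "\<dots> = 1 - cdf std_normal_distribution x"
    unfolding cdf_def by (rule prob_compl) auto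
  finally show ?thesis by simp
qed

lemma Qfun_strict_antimono:
  assumes "x < y"
  shows "Qfun y < Qfun x"
proof -
  interpret real_distribution std_normal_distribution
    by (rule real_dist_normal_dist)
  have "{x<..y} \<notin> null_sets lborel"
    using assms by (simp add: null_sets_def)
  then have "0 < prob {x<..y}"
    using measure_std_normal_eq_0_iff[of "{x<..y}"] by (simp add: zero_less_measure_iff)
  then show ?thesis
    using cdf_diff_eq[OF assms] by (simp add: Qfun_eq_cdf)
qed

lemma Qfun_zero: "Qfun 0 = 1 / 2"
proof -
  \<comment> \<open>The substitution \<open>t = sqrt 2 * s\<close> turns the integral into half the
    Gaussian integral.\<close>
  have "(LBINT t:{0::real..}. exp (- (t\<^sup>2 / 2)))
      = sqrt 2 * (LBINT s. indicator {0::real..} s *\<^sub>R exp (- s\<^sup>2))"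
    unfolding set_lebesgue_integral_def
    by (subst lborel_integral_real_affine[where c = "sqrt 2" and t = 0])
       (auto intro!: Bochner_Integration.integral_cong
         simp: indicator_def power_mult_distrib zero_le_mult_iff)
  also have "\<dots> = sqrt 2 * (sqrt pi / 2)"
    by (simp only: has_bochner_integral_integral_eq[OF gaussian_moment_0])
  finally show ?thesis
    by (simp add: Qfun_def real_sqrt_mult)
qed

text \<open>Since \<open>Qinv\<close> is an unrestricted \<open>inv\<close>, it suffices that
  \<open>p\<close> lies in the range of \<open>Qfun\<close>. The limits of the cdf at both ends and
  the intermediate value theorem provide a preimage.\<close>

lemma Qfun_Qinv:
  assumes "0 < p" and "p < 1"
  shows "Qfun (Qinv p) = p"
proof -
  interpret real_distribution std_normal_distribution
    by (rule real_dist_normal_dist)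
  let ?F = "cdf std_normal_distribution"
  have "eventually (\<lambda>x. ?F x < 1 - p) at_bot"
    using assms cdf_lim_at_bot by (intro order_tendstoD(2)) auto
  then obtain a where a: "?F a < 1 - p"
    by (auto simp: eventually_at_bot_linorder)
  have "eventually (\<lambda>x. 1 - p < ?F x) at_top"
    using assms cdf_lim_at_top_prob by (intro order_tendstoD(1)) auto
  then obtain b where b: "1 - p < ?F b"
    by (auto simp: eventually_at_top_linorder)
  have "a \<le> b"
    using a b cdf_nondecreasing[of b a] by linarith
  moreover have "isCont ?F x" for x
    unfolding isCont_cdf by (subst measure_std_normal_eq_0_iff) auto
  ultimately obtain x where "?F x = 1 - p"
    using IVT[of ?F a "1 - p" b] a b by auto
  then have "p \<in> range Qfun"
    by (auto simp: Qfun_eq_cdf image_iff intro!: exI[of _ x])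
  then show ?thesis
    unfolding Qinv_def by (rule f_inv_into_f)
qed

text \<open>Turns the error constraint into one on the SNR sum. The bound \<open>p < 1 / 2\<close>
  forces \<open>Qinv p\<close> to be positive, so squaring preserves the inequality.\<close>

lemma Qfun_half_sqrt_le_iff:
  assumes "0 < p" and "p < 1 / 2"
  shows "Qfun (1 / 2 * sqrt s) \<le> p \<longleftrightarrow> 4 * (Qinv p)\<^sup>2 \<le> s"
proof -
  let ?q = "Qinv p"
  have q: "Qfun ?q = p"
    using assms by (intro Qfun_Qinv) auto
  have q_pos: "0 < ?q"
  proof (rule ccontr)
    assume "\<not> 0 < ?q"
    then have "Qfun 0 \<le> Qfun ?q"
      using Qfun_strict_antimono[of ?q 0] by (cases "?q = 0") auto
    then show False
      using q assms Qfun_zero by simp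
  qed
  have "Qfun (1 / 2 * sqrt s) \<le> p \<longleftrightarrow> ?q \<le> 1 / 2 * sqrt s"
    using q Qfun_strict_antimono[of ?q "1 / 2 * sqrt s"] Qfun_strict_antimono[of "1 / 2 * sqrt s" ?q]
    by (metis linorder_less_linear not_le order_less_imp_le order_refl)
  also have "\<dots> \<longleftrightarrow> 2 * ?q \<le> sqrt s"
    by auto
  \<comment> \<open>No sign condition on \<open>s\<close> arises: \<open>sqrt\<close> is odd, hence
    strictly increasing on all reals.\<close>
  also have "\<dots> \<longleftrightarrow> (2 * ?q)\<^sup>2 \<le> s"
    using q_pos real_sqrt_le_iff[of "(2 * ?q)\<^sup>2" s] unfolding real_sqrt_abs by simp
  finally show ?thesis
    by (simp add: power_mult_distrib)
qed

section \<open>SNR against cost for a single user\<close>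

text \<open>Here \<open>a\<close> stands for the squared gain, \<open>k\<close> for the sample
  number, \<open>G\<close>, \<open>H\<close>, \<open>s\<close>, \<open>c\<close>, \<open>x\<close>
  for \<gamma>, |h|, \<sigma>t, c0, \<xi>; the factor before the cost is then
  \<open>rho\<close>.\<close>

lemma snr_le_cost_bound:
  fixes a k H s c x G :: real
  assumes "0 \<le> a" "0 \<le> k" "0 < H" "0 < s" "0 < c" "0 < x"
  shows "a * k * G\<^sup>2 * H\<^sup>2 / (a * H\<^sup>2 + k * s\<^sup>2)
    \<le> G\<^sup>2 * H\<^sup>2 / (s * sqrt x + H * sqrt c)\<^sup>2 * (c * k + x * a)"
proof (cases "a = 0 \<and> k = 0")
  case True
  then show ?thesis by simp
next
  case False
  \<comment> \<open>Naming the roots makes the inequality polynomial once denominators are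
    cleared.\<close>
  define y z where "y = sqrt x" and "z = sqrt c"
  have yz: "x = y\<^sup>2" "c = z\<^sup>2" "0 < y" "0 < z"
    using assms by (auto simp: y_def z_def)
  have den: "0 < a * H\<^sup>2 + k * s\<^sup>2"
    using False assms by (auto intro: add_pos_nonneg add_nonneg_pos)
  have D: "0 < s * y + H * z"
    using assms yz by (simp add: add_pos_pos)
  \<comment> \<open>Cauchy--Schwarz; the defect is a perfect square.\<close>
  have "(a * H\<^sup>2 + k * s\<^sup>2) * (z\<^sup>2 * k + y\<^sup>2 * a) - a * k * (s * y + H * z)\<^sup>2
      = (a * H * y - k * s * z)\<^sup>2"
    by (simp add: power2_eq_square algebra_simps)
  then have "a * k * (s * y + H * z)\<^sup>2 \<le> (a * H\<^sup>2 + k * s\<^sup>2) * (z\<^sup>2 * k + y\<^sup>2 * a)"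
    by (metis diff_ge_0_iff_ge zero_le_power2)
  then have "G\<^sup>2 * H\<^sup>2 * (a * k * (s * y + H * z)\<^sup>2)
      \<le> G\<^sup>2 * H\<^sup>2 * ((a * H\<^sup>2 + k * s\<^sup>2) * (z\<^sup>2 * k + y\<^sup>2 * a))"
    by (intro mult_left_mono) auto
  moreover have "0 < (s * y + H * z)\<^sup>2"
    using D by simp
  ultimately show ?thesis
    using den yz(3,4) unfolding y_def[symmetric] z_def[symmetric] yz(1,2)
    by (simp add: divide_simps ac_simps)
qed

text \<open>Equality in the Cauchy--Schwarz step means
  \<open>a * H * sqrt x = k * s * sqrt c\<close>, which fixes the ratio of \<open>a\<close> and
  \<open>k\<close>; the remaining scale is set by SNR \<open>e\<close>.\<close>

lemma snr_at_optimum: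
  fixes G H s c x e :: real
  assumes "0 < G" "0 < H" "0 < s" "0 < c" "0 < x" "0 < e"
  defines "k \<equiv> e / G\<^sup>2 * (1 + sqrt (x / c) * (s / H))"
    and "a \<equiv> e * s\<^sup>2 / (G\<^sup>2 * H\<^sup>2) * (1 + sqrt (c / x) * (H / s))"
  shows "a * k * G\<^sup>2 * H\<^sup>2 / (a * H\<^sup>2 + k * s\<^sup>2) = e"
    and "G\<^sup>2 * H\<^sup>2 / (s * sqrt x + H * sqrt c)\<^sup>2 * (c * k + x * a) = e"
proof -
  define y z where "y = sqrt x" and "z = sqrt c"
  have yz: "x = y\<^sup>2" "c = z\<^sup>2" "0 < y" "0 < z"
    using assms by (auto simp: y_def z_def)
  define D where "D = s * y + H * z"
  have D: "0 < D"
    using assms yz by (simp add: D_def add_pos_pos)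
  have k: "k = e * D / (G\<^sup>2 * H * z)"
    using assms(1-6) yz by (simp add: k_def D_def real_sqrt_divide field_simps)
  have a: "a = e * s * D / (G\<^sup>2 * H\<^sup>2 * y)"
    using assms(1-6) yz by (simp add: a_def D_def real_sqrt_divide field_simps power2_eq_square)
  \<comment> \<open>Both summands contain \<open>D\<close>, and their sum produces a second factor
    \<open>D\<close>. Keeping \<open>D\<close> folded while denominators are cleared leaves a simple
    identity.\<close>
  have "a * H\<^sup>2 + k * s\<^sup>2 = e * s * D * D / (G\<^sup>2 * H * y * z)"
    using assms(1-6) yz(3,4)
    by (simp add: a k field_simps power2_eq_square) (simp add: D_def algebra_simps)
  then show "a * k * G\<^sup>2 * H\<^sup>2 / (a * H\<^sup>2 + k * s\<^sup>2) = e"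
    using assms(1-6) yz(3,4) D by (simp add: a k field_simps power2_eq_square)
  have "c * k + x * a = e * D * D / (G\<^sup>2 * H\<^sup>2)"
    using assms(1-6) yz(3,4) unfolding yz(1,2)
    by (simp add: a k field_simps power2_eq_square) (simp add: D_def algebra_simps)
  then show "G\<^sup>2 * H\<^sup>2 / (s * sqrt x + H * sqrt c)\<^sup>2 * (c * k + x * a) = e"
    using assms(1-6) D unfolding y_def[symmetric] z_def[symmetric] D_def[symmetric]
    by (simp add: field_simps power2_eq_square)
qed

section \<open>Optimality of serving the first user only\<close>

theorem theoremV1:
  fixes n :: nat and \<gamma> :: "nat \<Rightarrow> real" and h :: "nat \<Rightarrow> complex"
    and \<sigma>n \<sigma>v \<sigma>t c0 Pe \<epsilon> \<kappa>1 g1 :: real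
  assumes "n \<ge> 1"
    and "\<And>i. i \<in> {1..n} \<Longrightarrow> \<gamma> i > 0"
    and "\<And>i. i \<in> {1..n} \<Longrightarrow> h i \<noteq> 0"
    and "\<sigma>n\<^sup>2 > 0" and "\<sigma>v\<^sup>2 > 0"
    and "\<sigma>t\<^sup>2 = \<sigma>v\<^sup>2 / \<sigma>n ^ 4" and "\<sigma>t > 0"
    and "c0 > 0"
    and "0 < Pe" and "Pe < 1 / 2"
    and "\<And>i. i \<in> {1..<n} \<Longrightarrow> rho \<gamma> h \<sigma>n \<sigma>t c0 i \<ge> rho \<gamma> h \<sigma>n \<sigma>t c0 (i + 1)"
    and "\<epsilon> = 4 * (Qinv Pe)\<^sup>2"
    and "\<kappa>1 = \<epsilon> / (\<gamma> 1)\<^sup>2 * (1 + sqrt (xi \<sigma>n \<gamma> 1 / c0) * (\<sigma>t / cmod (h 1)))"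
    and "g1 = sqrt (\<epsilon> * \<sigma>t\<^sup>2 / ((\<gamma> 1)\<^sup>2 * (cmod (h 1))\<^sup>2) *
                      (1 + sqrt (c0 / xi \<sigma>n \<gamma> 1) * (cmod (h 1) / \<sigma>t)))"
  shows "optimal_solution n \<gamma> h \<sigma>n \<sigma>t c0 Pe
           (\<lambda>i\<in>{1..n}. if i = 1 then \<kappa>1 else 0) (\<lambda>i\<in>{1..n}. if i = 1 then g1 else 0)"
proof -
  let ?\<kappa> = "\<lambda>i\<in>{1..n}. if i = 1 then \<kappa>1 else 0"
  let ?g = "\<lambda>i\<in>{1..n}. if i = 1 then g1 else 0"
  let ?\<rho> = "rho \<gamma> h \<sigma>n \<sigma>t c0"
  let ?\<xi> = "xi \<sigma>n \<gamma>"
  have \<xi>_pos: "?\<xi> i > 0" if "i \<in> {1..n}" for i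
    using assms(2)[OF that] \<open>\<sigma>n\<^sup>2 > 0\<close> by (auto simp: xi_def pi_one_def intro!: mult_pos_pos add_pos_pos)
  have one: "1 \<in> {1..n}"
    using \<open>n \<ge> 1\<close> by simp
  have \<epsilon>_iff: "error_prob n \<gamma> h \<sigma>t \<kappa> g \<le> Pe \<longleftrightarrow> \<epsilon> \<le> (\<Sum>i = 1..n. snr_term \<gamma> h \<sigma>t \<kappa> g i)" for \<kappa> g
    unfolding error_prob_def \<open>\<epsilon> = _\<close> by (rule Qfun_half_sqrt_le_iff) fact+
  \<comment> \<open>Zero SNR violates the constraint, so the threshold \<epsilon> must be
    positive.\<close>
  have "Qfun (1 / 2 * sqrt 0) > Pe"
    using \<open>Pe < 1 / 2\<close> by (simp add: Qfun_zero)
  then have \<epsilon>_pos: "\<epsilon> > 0"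
    using Qfun_half_sqrt_le_iff[OF \<open>0 < Pe\<close> \<open>Pe < 1 / 2\<close>, of 0] \<open>\<epsilon> = _\<close> by simp
  have \<rho>_le: "?\<rho> i \<le> ?\<rho> 1" if "i \<in> {1..n}" for i
  proof -
    have "1 \<le> i" "i \<le> n"
      using that by auto
    then show ?thesis
    \<comment> \<open>The ordering is assumed for neighbours only; induction upwards from 1 chains
      it.\<close>
    proof (induction i rule: dec_induct)
      case (step m)
      then show ?case
        using assms(11)[of m] by auto
    qed simp
  qed
  have g1_sq: "g1\<^sup>2 = \<epsilon> * \<sigma>t\<^sup>2 / ((\<gamma> 1)\<^sup>2 * (cmod (h 1))\<^sup>2) *
      (1 + sqrt (c0 / ?\<xi> 1) * (cmod (h 1) / \<sigma>t))"
    unfolding \<open>g1 = _\<close> using \<epsilon>_pos \<open>\<sigma>t > 0\<close> \<open>c0 > 0\<close> \<xi>_pos[OF one]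
    by (subst real_sqrt_pow2) auto
  note opt = snr_at_optimum[OF assms(2)[OF one] _ \<open>\<sigma>t > 0\<close> \<open>c0 > 0\<close> \<xi>_pos[OF one] \<epsilon>_pos,
      of "cmod (h 1)", folded g1_sq \<open>\<kappa>1 = _\<close>]
  have "\<kappa>1 > 0"
    unfolding \<open>\<kappa>1 = _\<close> using \<epsilon>_pos assms(2,3)[OF one] \<open>\<sigma>t > 0\<close> \<open>c0 > 0\<close> \<xi>_pos[OF one]
    by (intro mult_pos_pos divide_pos_pos add_pos_nonneg) auto
  \<comment> \<open>Positivity of \<kappa>1 rules out the default branch of \<open>snr_term\<close>
    for user 1; every other user falls into it.\<close>
  have snr: "snr_term \<gamma> h \<sigma>t ?\<kappa> ?g i = (if i = 1 then \<epsilon> else 0)" if "i \<in> {1..n}" for i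
    using that opt(1) assms(3)[OF one] \<open>\<kappa>1 > 0\<close> by (auto simp: snr_term_def)
  have cost: "system_cost n c0 \<sigma>n \<gamma> ?\<kappa> ?g = c0 * \<kappa>1 + ?\<xi> 1 * g1\<^sup>2"
  proof -
    have "system_cost n c0 \<sigma>n \<gamma> ?\<kappa> ?g
        = (\<Sum>i = 1..n. if i = 1 then c0 * \<kappa>1 + ?\<xi> 1 * g1\<^sup>2 else 0)"
      unfolding system_cost_def by (rule sum.cong) auto
    then show ?thesis
      using one by simp
  qed
  have cost_opt: "?\<rho> 1 * system_cost n c0 \<sigma>n \<gamma> ?\<kappa> ?g = \<epsilon>"
    unfolding cost rho_def using assms(3)[OF one] by (intro opt(2)) simp
  have "(\<Sum>i = 1..n. snr_term \<gamma> h \<sigma>t ?\<kappa> ?g i) = (\<Sum>i = 1..n. if i = 1 then \<epsilon> else 0)"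
    by (intro sum.cong refl snr)
  then have "(\<Sum>i = 1..n. snr_term \<gamma> h \<sigma>t ?\<kappa> ?g i) = \<epsilon>"
    using one by simp
  then have feas: "feasible n \<gamma> h \<sigma>t Pe ?\<kappa> ?g"
    using \<open>\<kappa>1 > 0\<close> \<epsilon>_pos \<open>\<sigma>t > 0\<close> \<open>c0 > 0\<close> \<xi>_pos[OF one]
    by (auto simp: feasible_def \<epsilon>_iff nonneg_vecs_def \<open>g1 = _\<close>)
  have "system_cost n c0 \<sigma>n \<gamma> ?\<kappa> ?g \<le> system_cost n c0 \<sigma>n \<gamma> \<kappa> g"
    if f: "feasible n \<gamma> h \<sigma>t Pe \<kappa> g" for \<kappa> g
  proof -
    have nonneg: "\<kappa> i \<ge> 0" "g i \<ge> 0" if "i \<in> {1..n}" for i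
      using f that by (auto simp: feasible_def nonneg_vecs_def)
    have term_le: "snr_term \<gamma> h \<sigma>t \<kappa> g i \<le> ?\<rho> 1 * (c0 * \<kappa> i + ?\<xi> i * (g i)\<^sup>2)"
      if i: "i \<in> {1..n}" for i
    proof -
      have "snr_term \<gamma> h \<sigma>t \<kappa> g i \<le> ?\<rho> i * (c0 * \<kappa> i + ?\<xi> i * (g i)\<^sup>2)"
        using snr_le_cost_bound[of "(g i)\<^sup>2" "\<kappa> i" "cmod (h i)" \<sigma>t c0 "?\<xi> i" "\<gamma> i"]
          nonneg[OF i] assms(3)[OF i] \<xi>_pos[OF i] \<open>\<sigma>t > 0\<close> \<open>c0 > 0\<close>
        by (auto simp: snr_term_def rho_def)
      also have "\<dots> \<le> ?\<rho> 1 * (c0 * \<kappa> i + ?\<xi> i * (g i)\<^sup>2)"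
        using nonneg[OF i] \<xi>_pos[OF i] \<open>c0 > 0\<close> by (intro mult_right_mono \<rho>_le i) auto
      finally show ?thesis .
    qed
    \<comment> \<open>The costs are compared after scaling by \<open>?\<rho> 1\<close>, which turns
      the candidate's cost into the SNR threshold.\<close>
    have "?\<rho> 1 * system_cost n c0 \<sigma>n \<gamma> ?\<kappa> ?g = \<epsilon>"
      by (rule cost_opt)
    also have "\<epsilon> \<le> (\<Sum>i = 1..n. snr_term \<gamma> h \<sigma>t \<kappa> g i)"
      using f by (simp add: feasible_def \<epsilon>_iff)
    also have "\<dots> \<le> ?\<rho> 1 * system_cost n c0 \<sigma>n \<gamma> \<kappa> g"
      unfolding system_cost_def sum_distrib_left by (rule sum_mono) (rule term_le)
    finally show ?thesis
    proof (rule mult_left_le_imp_le)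
      \<comment> \<open>As a quotient of squares it is nonnegative, and it is nonzero because its
        product with the candidate's cost is \<epsilon>.\<close>
      show "?\<rho> 1 > 0"
        using cost_opt \<epsilon>_pos by (intro order_neq_le_trans) (auto simp: rho_def)
    qed
  qed
  with feas show ?thesis
    by (force simp: optimal_solution_def is_arg_min_def not_less)
qed

end
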